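(* Let $X$ be a set, $E$ a nonempty set of parameters, $N\ge 1$ an integer, let $(X,\mathcal{T}_i,N,E)$ be an $N$-wise soft $T_0$-space over $X$, and let $Y$ be a nonempty subset of $X$. Then the soft $N$-topological subspace $(Y,\mathcal{T}_{i,Y},N,E)$ of $(X,\mathcal{T}_i,N,E)$ on $Y$ is an $N$-wise soft $T_0$-space.
   Context: A soft set over a set $Z$ (with respect to the fixed nonempty parameter set $E$) is a pair $(F,E)$ where $F:E\to\mathcal{P}(Z)$ is any map. The null soft set has $F(e)=\emptyset$ for all $e$; the absolute soft set over $Z$ has $F(e)=Z$ for all $e$. Soft unions and soft intersections are defined parameterwise: the soft union of $\{(F_i,E)\}_{i\in I}$ is given by $e\mapsto\bigcup_i F_i(e)$ and the soft intersection of $(F,E)$ and $(G,E)$ by $e\mapsto F(e)\cap G(e)$. A soft topology on $Z$ with respect to $E$ is a family $\mathcal{T}$ of soft sets over $Z$ that contains the null and the absolute soft sets, and is closed under soft intersections of two members and under arbitrary soft unions. A soft $N$-topological space $(Z,\mathcal{T}_i,N,E)$ over $Z$ is the set $Z$ equipped with $N$ different soft topologies $\mathcal{T}_1,\dots,\mathcal{T}_N$ on $Z$ with respect to the same $E$. A soft set over $Z$ is a soft $N$-open set if it belongs to $\mathcal{T}_j$ for some $j\in\{1,\dots,N\}$. For a nonempty $Y\subseteq X$, the soft relative topology on $Y$ of a soft topology $\mathcal{T}$ on $X$ is $\mathcal{T}_Y=\{({}^{Y}F,E) : (F,E)\in\mathcal{T}\}$, where ${}^{Y}F(e)=F(e)\cap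 Y$ for all $e\in E$. The soft $N$-topological subspace of $(X,\mathcal{T}_i,N,E)$ on $Y$ is the soft $N$-topological space $(Y,\mathcal{T}_{i,Y},N,E)$, i.e. $Y$ equipped with the soft relative topologies $\mathcal{T}_{1,Y},\dots,\mathcal{T}_{N,Y}$ of $\mathcal{T}_1,\dots,\mathcal{T}_N$ on $Y$. For $x\in Z$ and $\alpha\in E$, the soft point $(x_\alpha,E)$ over $Z$ is the soft set with value $\{x\}$ at $\alpha$ and $\emptyset$ at every other parameter. It soft belongs to $(F,E)$ iff $x\in F(\alpha)$. Soft points $(x_\alpha,E)$ and $(y_\beta,E)$ are distinct iff $x\ne y$ or $\alpha\ne\beta$. A soft $N$-topological space over $Z$ is an $N$-wise soft $T_0$-space if for every pair of distinct soft points over $Z$ there exists a soft $N$-open set to which exactly one of the two soft points soft belongs.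
   Formalization: The N soft topologies are not required to be pairwise different, neither on X nor on the subspace Y, because different soft topologies on X can have the same soft relative topology on Y. *)

theory Defs
  imports Main "HOL-Library.FuncSet"
begin

text \<open>
  A soft set over \<open>Z\<close> with parameter set \<open>E\<close> is a map from \<open>E\<close> to the subsets of \<open>Z\<close>.
  Such maps are taken extensional on \<open>E\<close>, so that equality in HOL
  is equality of maps on \<open>E\<close>.
\<close>

type_synonym ('e, 'a) soft_set = "'e \<Rightarrow> 'a set"

definition soft_sets :: "'a set \<Rightarrow> 'e set \<Rightarrow> ('e, 'a) soft_set set" where
  "soft_sets Z E = (E \<rightarrow>\<^sub>E Pow Z)"

definition null_soft_set :: "'e set \<Rightarrow> ('e, 'a) soft_set" where
  "null_soft_set E = (\<lambda>e\<in>E. {})"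

definition absolute_soft_set :: "'a set \<Rightarrow> 'e set \<Rightarrow> ('e, 'a) soft_set" where
  "absolute_soft_set Z E = (\<lambda>e\<in>E. Z)"

definition soft_inter :: "'e set \<Rightarrow> ('e, 'a) soft_set \<Rightarrow> ('e, 'a) soft_set \<Rightarrow> ('e, 'a) soft_set" where
  "soft_inter E F G = (\<lambda>e\<in>E. F e \<inter> G e)"

definition soft_Union :: "'e set \<Rightarrow> ('e, 'a) soft_set set \<Rightarrow> ('e, 'a) soft_set" where
  "soft_Union E S = (\<lambda>e\<in>E. \<Union>F\<in>S. F e)"

definition soft_topology :: "'a set \<Rightarrow> 'e set \<Rightarrow> ('e, 'a) soft_set set \<Rightarrow> bool" where
  "soft_topology Z E T \<longleftrightarrow>
     T \<subseteq> soft_sets Z E \<and>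
     null_soft_set E \<in> T \<and>
     absolute_soft_set Z E \<in> T \<and>
     (\<forall>F\<in>T. \<forall>G\<in>T. soft_inter E F G \<in> T) \<and>
     (\<forall>S. S \<subseteq> T \<longrightarrow> soft_Union E S \<in> T)"

text \<open>
  The \<open>N\<close> topologies form a family indexed by \<open>{1..N}\<close>; values of \<open>T\<close> at other indices are
  irrelevant. The family is not required to be injective: different topologies on a set can have
  the same relative topology on a subset, so with pairwise distinctness a subspace would in general
  not be a soft \<open>N\<close>-topological space.
\<close>

definition soft_N_topological_space ::
    "'a set \<Rightarrow> (nat \<Rightarrow> ('e, 'a) soft_set set) \<Rightarrow> nat \<Rightarrow> 'e set \<Rightarrow> bool" where
  "soft_N_topological_space Z T N E \<longleftrightarrow> (\<forall>i\<in>{1..N}. soft_topology Z E (T i))"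

definition soft_N_open ::
    "(nat \<Rightarrow> ('e, 'a) soft_set set) \<Rightarrow> nat \<Rightarrow> ('e, 'a) soft_set \<Rightarrow> bool" where
  "soft_N_open T N F \<longleftrightarrow> (\<exists>j\<in>{1..N}. F \<in> T j)"

definition soft_restrict :: "'a set \<Rightarrow> 'e set \<Rightarrow> ('e, 'a) soft_set \<Rightarrow> ('e, 'a) soft_set" where
  "soft_restrict Y E F = (\<lambda>e\<in>E. F e \<inter> Y)"

definition soft_relative_topology ::
    "'a set \<Rightarrow> 'e set \<Rightarrow> ('e, 'a) soft_set set \<Rightarrow> ('e, 'a) soft_set set" where
  "soft_relative_topology Y E T = {soft_restrict Y E F | F. F \<in> T}"

definition soft_point :: "'e set \<Rightarrow> 'a \<Rightarrow> 'e \<Rightarrow> ('e, 'a) soft_set" where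
  "soft_point E x \<alpha> = (\<lambda>e\<in>E. if e = \<alpha> then {x} else {})"

text \<open>Membership applies to soft points only; it is false when \<open>P\<close> is not a soft point.\<close>

definition soft_belongs :: "'e set \<Rightarrow> ('e, 'a) soft_set \<Rightarrow> ('e, 'a) soft_set \<Rightarrow> bool" where
  "soft_belongs E P F \<longleftrightarrow> (\<exists>x. \<exists>\<alpha>\<in>E. P = soft_point E x \<alpha> \<and> x \<in> F \<alpha>)"

lemma soft_point_eq_iff:
  assumes "\<alpha> \<in> E" "\<beta> \<in> E"
  shows "soft_point E x \<alpha> = soft_point E y \<beta> \<longleftrightarrow> x = y \<and> \<alpha> = \<beta>"
proof
  assume "soft_point E x \<alpha> = soft_point E y \<beta>"
  then have "soft_point E x \<alpha> \<alpha> = soft_point E y \<beta> \<alpha>" by simp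
  then show "x = y \<and> \<alpha> = \<beta>"
    using assms by (simp add: soft_point_def split: if_splits)
qed simp

lemma soft_belongs_soft_point_iff:
  assumes "\<alpha> \<in> E"
  shows "soft_belongs E (soft_point E x \<alpha>) F \<longleftrightarrow> x \<in> F \<alpha>"
  using assms by (auto simp: soft_belongs_def soft_point_eq_iff)

definition N_wise_soft_T0_space ::
    "'a set \<Rightarrow> (nat \<Rightarrow> ('e, 'a) soft_set set) \<Rightarrow> nat \<Rightarrow> 'e set \<Rightarrow> bool" where
  "N_wise_soft_T0_space Z T N E \<longleftrightarrow>
     soft_N_topological_space Z T N E \<and>
     (\<forall>x\<in>Z. \<forall>y\<in>Z. \<forall>\<alpha>\<in>E. \<forall>\<beta>\<in>E. x \<noteq> y \<or> \<alpha> \<noteq> \<beta> \<longrightarrow>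
        (\<exists>F. soft_N_open T N F \<and>
             (soft_belongs E (soft_point E x \<alpha>) F \<noteq> soft_belongs E (soft_point E y \<beta>) F)))"

end

theory Submission imports Defs begin

text \<open>
  Restriction to \<open>Y\<close> commutes with arbitrary soft unions and with binary soft intersections, since
  intersecting with \<open>Y\<close> distributes over both at each parameter, and for \<open>Y \<subseteq> X\<close>
  it sends the null and absolute soft sets over \<open>X\<close> to those over \<open>Y\<close>. Hence the relative
  topology of a soft topology is again a soft topology. Restriction also leaves membership of soft points over
  \<open>Y\<close> unchanged: for \<open>x \<in> Y\<close>, being in \<open>F \<alpha> \<inter> Y\<close> is being in \<open>F \<alpha>\<close>. So if \<open>F\<close> separates two
  soft points over \<open>Y\<close> in the large space, its restriction separates them in the subspace, and it
  is open there for the same index.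
\<close>

lemma soft_restrict_null: "soft_restrict Y E (null_soft_set E) = null_soft_set E"
  by (rule ext) (auto simp: soft_restrict_def null_soft_set_def)

lemma soft_restrict_absolute:
  assumes "Y \<subseteq> X"
  shows "soft_restrict Y E (absolute_soft_set X E) = absolute_soft_set Y E"
  using assms by (intro ext) (auto simp: soft_restrict_def absolute_soft_set_def)

lemma soft_restrict_inter:
  "soft_restrict Y E (soft_inter E F G) = soft_inter E (soft_restrict Y E F) (soft_restrict Y E G)"
  by (rule ext) (auto simp: soft_restrict_def soft_inter_def)

lemma soft_restrict_Union:
  "soft_restrict Y E (soft_Union E S) = soft_Union E (soft_restrict Y E ` S)"
  by (rule ext) (auto simp: soft_restrict_def soft_Union_def)

lemma soft_relative_topology_eq_image:
  "soft_relative_topology Y E T = soft_restrict Y E ` T"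
  by (auto simp: soft_relative_topology_def)

lemma soft_topology_relative:
  assumes T: "soft_topology X E T" and YX: "Y \<subseteq> X"
  shows "soft_topology Y E (soft_relative_topology Y E T)"
  unfolding soft_topology_def soft_relative_topology_eq_image
proof (intro conjI ballI allI impI)
  show "soft_restrict Y E ` T \<subseteq> soft_sets Y E"
    by (auto simp: soft_sets_def soft_restrict_def)
  show "null_soft_set E \<in> soft_restrict Y E ` T"
    using T by (metis soft_restrict_null soft_topology_def imageI)
  show "absolute_soft_set Y E \<in> soft_restrict Y E ` T"
    using T by (metis soft_restrict_absolute[OF YX] soft_topology_def imageI)
next
  fix F G assume "F \<in> soft_restrict Y E ` T" "G \<in> soft_restrict Y E ` T"
  then obtain F' G' where "F' \<in> T" "G' \<in> T"
    and FG: "F = soft_restrict Y E F'" "G = soft_restrict Y E G'" by blast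
  then have "soft_inter E F' G' \<in> T" using T by (simp add: soft_topology_def)
  then show "soft_inter E F G \<in> soft_restrict Y E ` T"
    unfolding FG soft_restrict_inter[symmetric] by (rule imageI)
next
  fix S assume "S \<subseteq> soft_restrict Y E ` T"
  then obtain S' where "S' \<subseteq> T" and S: "S = soft_restrict Y E ` S'"
    by (auto simp: subset_image_iff)
  then have "soft_Union E S' \<in> T" using T by (simp add: soft_topology_def)
  then show "soft_Union E S \<in> soft_restrict Y E ` T"
    unfolding S soft_restrict_Union[symmetric] by (rule imageI)
qed

lemma soft_belongs_soft_restrict_iff:
  assumes "x \<in> Y" "\<alpha> \<in> E"
  shows "soft_belongs E (soft_point E x \<alpha>) (soft_restrict Y E F) \<longleftrightarrow>
    soft_belongs E (soft_point E x \<alpha>) F"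
  using assms by (simp add: soft_belongs_soft_point_iff soft_restrict_def)

lemma soft_N_open_soft_restrict:
  assumes "soft_N_open T N F"
  shows "soft_N_open (\<lambda>i. soft_relative_topology Y E (T i)) N (soft_restrict Y E F)"
  using assms by (auto simp: soft_N_open_def soft_relative_topology_eq_image)

theorem proposition4p6:
  fixes X Y :: "'a set" and E :: "'e set" and N :: nat
    and T :: "nat \<Rightarrow> ('e, 'a) soft_set set"
  assumes "E \<noteq> {}"
    and "N \<ge> 1"
    and "N_wise_soft_T0_space X T N E"
    and "Y \<noteq> {}" and "Y \<subseteq> X"
  shows "N_wise_soft_T0_space Y (\<lambda>i. soft_relative_topology Y E (T i)) N E"
  unfolding N_wise_soft_T0_space_def
proof (intro conjI ballI impI)
  show "soft_N_topological_space Y (\<lambda>i. soft_relative_topology Y E (T i)) N E"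
    using assms(3,5) soft_topology_relative
    unfolding N_wise_soft_T0_space_def soft_N_topological_space_def by blast
next
  fix x y \<alpha> \<beta>
  assume xy: "x \<in> Y" "y \<in> Y" and ab: "\<alpha> \<in> E" "\<beta> \<in> E" and ne: "x \<noteq> y \<or> \<alpha> \<noteq> \<beta>"
  have "x \<in> X" "y \<in> X" using xy assms(5) by auto
  then obtain F where F: "soft_N_open T N F"
    and sep: "soft_belongs E (soft_point E x \<alpha>) F \<noteq> soft_belongs E (soft_point E y \<beta>) F"
    using assms(3) ab ne unfolding N_wise_soft_T0_space_def by blast
  show "\<exists>G. soft_N_open (\<lambda>i. soft_relative_topology Y E (T i)) N G \<and>
      soft_belongs E (soft_point E x \<alpha>) G \<noteq> soft_belongs E (soft_point E y \<beta>) G"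
  proof (intro exI conjI)
    show "soft_N_open (\<lambda>i. soft_relative_topology Y E (T i)) N (soft_restrict Y E F)"
      using F by (rule soft_N_open_soft_restrict)
    show "soft_belongs E (soft_point E x \<alpha>) (soft_restrict Y E F) \<noteq>
        soft_belongs E (soft_point E y \<beta>) (soft_restrict Y E F)"
      using sep xy ab by (simp add: soft_belongs_soft_restrict_iff)
  qed
qed

end
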